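(* There is no non-adaptive offline probing algorithm $\mathcal{A}$ and constant $c>1-\frac1e$ such that $\mathbb{E}[w(\mathcal{A}(G))]\ge c\cdot\mathrm{OPT}(G)$ for every stochastic graph $G$ with downward-closed probing constraints (in the known stochastic graph setting).
   Context: A stochastic graph is a finite bipartite graph $G=(U,V,E)$, $E=U\times V$, with nonnegative weights $(w_e)$ and probabilities $(p_e)\subseteq[0,1]$; each edge is independently active with probability $p_e$, its state hidden until probed. $S^{( * )}$: tuples of distinct elements of $S$, including the empty string; $\partial(v)$: edges at $v$. Each $v\in V$ has $\mathcal{C}_v\subseteq\partial(v)^{( * )}$, downward-closed (closed under substrings and permutations). Probe-commit model: if a probed edge is active, the algorithm must irrevocably decide whether to add it to its matching before the next probe; only probed active edges can be added; output must be a matching. An offline probing algorithm knows $G$ (not the states) and probes edges in any order, possibly adaptively and randomly, such that for each $v$ the probed edges of $\partial(v)$ in order form a string in $\mathcal{C}_v$; $\mathcal{A}(G)$ denotes its output matching and $w(M)=\sum_{e\in M}w_e$. $\mathrm{OPT}(G)$ (the adaptive benchmark) is the supremum over offline probing algorithms of $\mathbb{E}[w(\mathcal{A}(G))]$. An offline probing algorithm is non-adaptive if the edges it probes (and their order) are a (randomized) function of $G$ only, i.e. statistically independent of the edge states. *)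

theory Defs
  imports
    "HOL-Probability.Probability"
    "HOL-Library.Sublist"
    "HOL-Library.Multiset"
    "HOL-Library.Infinite_Typeclass"
begin

record ('u, 'v) sgraph =
  left_verts :: "'u set"
  right_verts :: "'v set"
  weight :: "'u \<times> 'v \<Rightarrow> real"
  prob_active :: "'u \<times> 'v \<Rightarrow> real"
  constr :: "'v \<Rightarrow> ('u \<times> 'v) list set"

definition edges :: "('u, 'v) sgraph \<Rightarrow> ('u \<times> 'v) set" where
  "edges G = left_verts G \<times> right_verts G"

definition incident :: "('u, 'v) sgraph \<Rightarrow> 'v \<Rightarrow> ('u \<times> 'v) set" where
  "incident G v = {e \<in> edges G. snd e = v}"

definition distinct_strings :: "'a set \<Rightarrow> 'a list set" where
  "distinct_strings S = {xs. distinct xs \<and> set xs \<subseteq> S}"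

text \<open>In the presence of closure under permutations it is immaterial whether a substring is
  required to be contiguous. The family must be nonempty: otherwise not even the empty string of
  probes would be permitted at the vertex, and no probing algorithm would exist at all.\<close>

definition downward_closed :: "'a list set \<Rightarrow> bool" where
  "downward_closed C \<longleftrightarrow> C \<noteq> {} \<and>
     (\<forall>xs\<in>C. \<forall>ys. sublist ys xs \<longrightarrow> ys \<in> C) \<and>
     (\<forall>xs\<in>C. \<forall>ys. mset ys = mset xs \<longrightarrow> ys \<in> C)"

definition stochastic_graph :: "('u, 'v) sgraph \<Rightarrow> bool" where
  "stochastic_graph G \<longleftrightarrow>
     finite (left_verts G) \<and> finite (right_verts G) \<and>
     (\<forall>e\<in>edges G. 0 \<le> weight G e) \<and>
     (\<forall>e\<in>edges G. 0 \<le> prob_active G e \<and> prob_active G e \<le> 1) \<and>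
     (\<forall>v\<in>right_verts G.
        constr G v \<subseteq> distinct_strings (incident G v) \<and> downward_closed (constr G v))"

definition edge_states :: "('u, 'v) sgraph \<Rightarrow> ('u \<times> 'v \<Rightarrow> bool) pmf" where
  "edge_states G = Pi_pmf (edges G) False (\<lambda>e. bernoulli_pmf (prob_active G e))"

text \<open>A deterministic probe-commit strategy is a decision tree. In \<open>Probe e t\<^sub>0 b t\<^sub>1\<close> the edge \<open>e\<close> is
  probed; if it is inactive, the strategy continues with \<open>t\<^sub>0\<close>; if it is active, it is irrevocably
  added to the matching iff \<open>b\<close> holds, and the strategy continues with \<open>t\<^sub>1\<close>. The next action thus
  depends exactly on the states of the edges probed so far, and only probed active edges are
  added. Finite trees suffice, as no edge may be probed twice.\<close>

datatype 'e strategy = Stop | Probe 'e "'e strategy" bool "'e strategy"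

fun probed :: "'e strategy \<Rightarrow> ('e \<Rightarrow> bool) \<Rightarrow> 'e list" where
  "probed Stop \<sigma> = []"
| "probed (Probe e t\<^sub>0 b t\<^sub>1) \<sigma> = e # probed (if \<sigma> e then t\<^sub>1 else t\<^sub>0) \<sigma>"

fun matched :: "'e strategy \<Rightarrow> ('e \<Rightarrow> bool) \<Rightarrow> 'e set" where
  "matched Stop \<sigma> = {}"
| "matched (Probe e t\<^sub>0 b t\<^sub>1) \<sigma> =
     (if \<sigma> e then (if b then {e} else {}) \<union> matched t\<^sub>1 \<sigma> else matched t\<^sub>0 \<sigma>)"

definition is_matching :: "('u, 'v) sgraph \<Rightarrow> ('u \<times> 'v) set \<Rightarrow> bool" where
  "is_matching G M \<longleftrightarrow> M \<subseteq> edges G \<and> inj_on fst M \<and> inj_on snd M"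

text \<open>A randomized algorithm, run on a given graph, is a distribution of decision trees: its
  internal random choices are drawn independently of the edge states.\<close>

definition execution ::
  "('u, 'v) sgraph \<Rightarrow> ('u \<times> 'v) strategy pmf \<Rightarrow>
     (('u \<times> 'v) strategy \<times> ('u \<times> 'v \<Rightarrow> bool)) pmf" where
  "execution G A = pair_pmf A (edge_states G)"

definition offline_probing :: "('u, 'v) sgraph \<Rightarrow> ('u \<times> 'v) strategy pmf \<Rightarrow> bool" where
  "offline_probing G A \<longleftrightarrow> (\<forall>(T, \<sigma>) \<in> set_pmf (execution G A).
     set (probed T \<sigma>) \<subseteq> edges G \<and>
     (\<forall>v\<in>right_verts G. filter (\<lambda>e. snd e = v) (probed T \<sigma>) \<in> constr G v) \<and>
     is_matching G (matched T \<sigma>))"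

definition expected_weight :: "('u, 'v) sgraph \<Rightarrow> ('u \<times> 'v) strategy pmf \<Rightarrow> real" where
  "expected_weight G A =
     measure_pmf.expectation (execution G A) (\<lambda>(T, \<sigma>). \<Sum>e\<in>matched T \<sigma>. weight G e)"

definition OPT :: "('u, 'v) sgraph \<Rightarrow> real" where
  "OPT G = Sup {expected_weight G A | A. offline_probing G A}"

text \<open>The sequence of probed edges is statistically independent of the edge states: the joint law
  of the two is the product of its marginals.\<close>

definition non_adaptive :: "('u, 'v) sgraph \<Rightarrow> ('u \<times> 'v) strategy pmf \<Rightarrow> bool" where
  "non_adaptive G A \<longleftrightarrow>
     map_pmf (\<lambda>(T, \<sigma>). (probed T \<sigma>, \<sigma>)) (execution G A) =
     pair_pmf (map_pmf (\<lambda>(T, \<sigma>). probed T \<sigma>) (execution G A)) (edge_states G)"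

text \<open>The supremum of reals defining \<open>OPT\<close> is taken over a nonempty set that is bounded above.\<close>

lemma OPT_set_nonempty:
  assumes "stochastic_graph G"
  shows "{expected_weight G A | A. offline_probing G A} \<noteq> {}"
proof -
  have "[] \<in> constr G v" if "v \<in> right_verts G" for v
  proof -
    have "downward_closed (constr G v)"
      using assms that by (simp add: stochastic_graph_def)
    then show ?thesis
      unfolding downward_closed_def by (metis sublist_Nil_left ex_in_conv)
  qed
  then have "offline_probing G (return_pmf Stop)"
    by (auto simp: offline_probing_def execution_def is_matching_def)
  then show ?thesis by blast
qed

lemma expected_weight_le:
  assumes G: "stochastic_graph G" and A: "offline_probing G A"
  shows "expected_weight G A \<le> (\<Sum>e\<in>edges G. weight G e)"
proof -
  let ?W = "\<Sum>e\<in>edges G. weight G e"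
  let ?f = "\<lambda>(T, \<sigma>). \<Sum>e\<in>matched T \<sigma>. weight G e"
  have fin: "finite (edges G)" and nonneg: "\<And>e. e \<in> edges G \<Longrightarrow> 0 \<le> weight G e"
    using G by (auto simp: stochastic_graph_def edges_def)
  have bound: "0 \<le> ?f x \<and> ?f x \<le> ?W" if x: "x \<in> set_pmf (execution G A)" for x
  proof (cases x)
    case (Pair T \<sigma>)
    then have sub: "matched T \<sigma> \<subseteq> edges G"
      using A x by (auto simp: offline_probing_def is_matching_def)
    show ?thesis
      using sub fin nonneg Pair by (auto intro!: sum_nonneg sum_mono2)
  qed
  have "integrable (measure_pmf (execution G A)) ?f"
    by (rule measure_pmf.integrable_const_bound[where B = ?W])
      (use bound in \<open>auto simp: AE_measure_pmf_iff\<close>)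
  then have "measure_pmf.expectation (execution G A) ?f \<le>
      measure_pmf.expectation (execution G A) (\<lambda>_. ?W)"
    by (intro integral_mono_AE) (use bound in \<open>auto simp: AE_measure_pmf_iff\<close>)
  then show ?thesis by (simp add: expected_weight_def)
qed

lemma OPT_set_bdd_above:
  assumes "stochastic_graph G"
  shows "bdd_above {expected_weight G A | A. offline_probing G A}"
  using expected_weight_le[OF assms] by (auto intro!: bdd_aboveI)

end

theory Submission
  imports Defs
begin

text \<open>
  Let \<open>k\<close> offline vertices face \<open>k\<^sup>2\<close> vertices that may each be probed once, all edges having weight
  \<open>1\<close> and probability \<open>1/k\<close>. An adaptive algorithm always probes a vertex that is still free, so it
  matches \<open>min k X\<close> vertices for a binomial variable \<open>X\<close> of mean \<open>k\<close> and variance less than \<open>k\<close>,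
  which is \<open>k - O(\<surd>k)\<close> in expectation. A non-adaptive algorithm fixes numbers \<open>n\<^sub>u\<close> of probes at the
  offline vertices \<open>u\<close> whose sum is at most \<open>k\<^sup>2\<close>; by convexity it matches at most
  \<open>(\<Sum>u. 1 - (1 - 1/k) ^ n\<^sub>u) \<le> k (1 - (1 - 1/k) ^ k)\<close> of them in expectation. The ratio of the two
  bounds tends to \<open>1 - 1/e\<close>.
\<close>

section \<open>Expectations under product distributions\<close>

text \<open>Fubini is applied to the nonnegative integral, since \<open>A\<close> may have infinite
  support and \<open>f\<close> may be unbounded. For the algorithms below this reduces a random
  probe sequence to a fixed one.\<close>

lemma expectation_pair_pmf_le:
  fixes f :: "'a \<times> 'b \<Rightarrow> real"
  assumes fin: "finite (set_pmf B)"
    and nonneg: "\<And>x. 0 \<le> f x"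
    and le: "\<And>a. a \<in> set_pmf A \<Longrightarrow> measure_pmf.expectation B (\<lambda>b. f (a, b)) \<le> C"
    and C: "0 \<le> C"
  shows "measure_pmf.expectation (pair_pmf A B) f \<le> C"
proof (rule integral_real_bounded[OF C])
  have "(\<integral>\<^sup>+ b. ennreal (f (a, b)) \<partial>B) \<le> ennreal C" if "a \<in> set_pmf A" for a
    using le[OF that] nonneg
    by (subst nn_integral_eq_integral)
      (auto intro!: integrable_measure_pmf_finite fin ennreal_leI)
  then have "(\<integral>\<^sup>+ a. \<integral>\<^sup>+ b. ennreal (f (a, b)) \<partial>B \<partial>A) \<le> (\<integral>\<^sup>+ a. ennreal C \<partial>A)"
    by (intro nn_integral_mono_AE) (auto simp: AE_measure_pmf_iff)
  then show "(\<integral>\<^sup>+ x. ennreal (f x) \<partial>pair_pmf A B) \<le> ennreal C"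
    by (simp add: nn_integral_pair_pmf')
qed

lemma finite_set_Pi_bernoulli:
  "finite A \<Longrightarrow> finite (set_pmf (Pi_pmf A False (\<lambda>e. bernoulli_pmf (p e))))"
  by (rule finite_subset[OF set_Pi_pmf_subset']) (auto intro!: finite_PiE_dflt)

text \<open>Conditioning on the state of \<open>x\<close>. Both branches are averaged over
  \<open>D\<close> itself rather than over the product on \<open>A - {x}\<close>, so that an
  induction can stay with one distribution.\<close>

lemma expectation_Pi_bernoulli_split:
  fixes g :: "('a \<Rightarrow> bool) \<Rightarrow> real"
  assumes "finite A" "x \<in> A" "0 \<le> p x" "p x \<le> 1"
  defines "D \<equiv> Pi_pmf A False (\<lambda>e. bernoulli_pmf (p e))"
  shows "measure_pmf.expectation D g =
    p x * measure_pmf.expectation D (\<lambda>\<sigma>. g (\<sigma>(x := True))) +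
    (1 - p x) * measure_pmf.expectation D (\<lambda>\<sigma>. g (\<sigma>(x := False)))"
proof -
  define D' where "D' = Pi_pmf (A - {x}) False (\<lambda>e. bernoulli_pmf (p e))"
  have fin: "finite (set_pmf D')"
    unfolding D'_def using assms by (intro finite_set_Pi_bernoulli) auto
  have D: "D = bernoulli_pmf (p x) \<bind> (\<lambda>y. map_pmf (\<lambda>f. f(x := y)) D')"
    using Pi_pmf_insert'[of "A - {x}" x False "\<lambda>e. bernoulli_pmf (p e)"] assms
    by (simp add: D_def D'_def insert_absorb map_pmf_def)
  have expand: "measure_pmf.expectation D h =
      p x * measure_pmf.expectation D' (\<lambda>f. h (f(x := True))) +
      (1 - p x) * measure_pmf.expectation D' (\<lambda>f. h (f(x := False)))"
    for h :: "('a \<Rightarrow> bool) \<Rightarrow> real"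
    unfolding D
    by (subst pmf_expectation_bind[of UNIV])
      (use assms fin in \<open>auto simp: UNIV_bool\<close>)
  \<comment> \<open>\<open>expand\<close> is applied to \<open>g\<close> and to both overwritten
    versions of \<open>g\<close>; in the latter a second update at \<open>x\<close> has no effect,
    so the two branches agree and their weights add up to 1.\<close>
  show ?thesis
    by (simp add: expand algebra_simps)
qed

lemma prob_Pi_bernoulli_all_False:
  fixes p :: real
  assumes "finite A" "B \<subseteq> A" "0 \<le> p" "p \<le> 1"
  shows "measure_pmf.prob (Pi_pmf A False (\<lambda>_. bernoulli_pmf p)) {\<sigma>. \<forall>e\<in>B. \<not> \<sigma> e}
    = (1 - p) ^ card B"
proof -
  have False_prob: "measure_pmf.prob (bernoulli_pmf p) {False} = 1 - p"
    using assms by (simp add: measure_pmf_single)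
  have "{\<sigma>. \<forall>e\<in>B. \<not> \<sigma> e} = Pi A (\<lambda>e. if e \<in> B then {False} else UNIV)"
    using assms by (fastforce simp: Pi_def)
  then have "measure_pmf.prob (Pi_pmf A False (\<lambda>_. bernoulli_pmf p)) {\<sigma>. \<forall>e\<in>B. \<not> \<sigma> e} =
      (\<Prod>e\<in>A. if e \<in> B then 1 - p else 1)"
    using assms False_prob by (simp add: measure_Pi_pmf_Pi if_distrib cong: if_cong)
  also have "\<dots> = (1 - p) ^ card B"
    using assms by (simp add: prod.If_cases Int_absorb1)
  finally show ?thesis .
qed

section \<open>The hard instances\<close>

definition unit_patience :: "'u set \<Rightarrow> 'v set \<Rightarrow> real \<Rightarrow> ('u, 'v) sgraph" where
  "unit_patience U V p =
    \<lparr>left_verts = U, right_verts = V, weight = (\<lambda>_. 1), prob_active = (\<lambda>_. p),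
     constr = (\<lambda>v. {xs. length xs \<le> 1 \<and> set xs \<subseteq> U \<times> {v}})\<rparr>"

lemma unit_patience_sel [simp]:
  "left_verts (unit_patience U V p) = U"
  "right_verts (unit_patience U V p) = V"
  "weight (unit_patience U V p) e = 1"
  "prob_active (unit_patience U V p) e = p"
  "xs \<in> constr (unit_patience U V p) v \<longleftrightarrow> length xs \<le> 1 \<and> set xs \<subseteq> U \<times> {v}"
  "edges (unit_patience U V p) = U \<times> V"
  "edge_states (unit_patience U V p) = Pi_pmf (U \<times> V) False (\<lambda>_. bernoulli_pmf p)"
  by (simp_all add: unit_patience_def edges_def edge_states_def)

lemma stochastic_graph_unit_patience:
  assumes "finite U" "finite V" "0 \<le> p" "p \<le> 1"
  shows "stochastic_graph (unit_patience U V p)"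
proof -
  have "constr (unit_patience U V p) v \<subseteq> distinct_strings (incident (unit_patience U V p) v)"
    if "v \<in> V" for v
  proof
    fix xs assume "xs \<in> constr (unit_patience U V p) v"
    then have "length xs \<le> 1" "set xs \<subseteq> U \<times> {v}" by auto
    then show "xs \<in> distinct_strings (incident (unit_patience U V p) v)"
      using that by (cases xs) (auto simp: distinct_strings_def incident_def)
  qed
  moreover have "downward_closed (constr (unit_patience U V p) v)" for v
  proof -
    have "[] \<in> constr (unit_patience U V p) v" by simp
    then have "constr (unit_patience U V p) v \<noteq> {}" by blast
    moreover have "length ys \<le> length xs \<and> set ys \<subseteq> set xs"
      if "sublist ys xs \<or> mset ys = mset xs" for xs ys :: "('a \<times> 'b) list"
      using that by (auto dest: sublist_length_le set_mono_sublist mset_eq_length mset_eq_setD)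
    ultimately show ?thesis
      unfolding downward_closed_def Ball_def unit_patience_sel by (meson order_trans)
  qed
  ultimately show ?thesis
    using assms by (simp add: stochastic_graph_def)
qed

section \<open>Non-adaptive algorithms\<close>

lemma matched_subset_probed: "matched T \<sigma> \<subseteq> {e \<in> set (probed T \<sigma>). \<sigma> e}"
  by (induction T) auto

text \<open>The left side is the tangent at \<open>k\<close> of the convex function sending
  \<open>n\<close> to \<open>q ^ n\<close>.\<close>

lemma power_ge_tangent:
  fixes q :: real
  assumes "0 < q"
  shows "q ^ k * (1 + (real n - real k) * ln q) \<le> q ^ n"
proof -
  have "1 + (real n - real k) * ln q \<le> exp ((real n - real k) * ln q)"
    by (rule exp_ge_add_one_self)
  also have "\<dots> = q ^ n / q ^ k"
    using assms by (simp add: left_diff_distrib exp_diff exp_of_nat_mult)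
  finally show ?thesis
    using assms by (simp add: field_simps)
qed

text \<open>Jensen by tangents at the target average \<open>k\<close>. An upper bound on the total
  suffices: the summed linear term is a product of two nonpositive factors, the deficit and
  \<open>ln q\<close>.\<close>

lemma card_mult_power_le_sum_power:
  fixes q :: real
  assumes "0 < q" "q \<le> 1" and le: "(\<Sum>u\<in>U. n u) \<le> card U * k"
  shows "real (card U) * q ^ k \<le> (\<Sum>u\<in>U. q ^ n u)"
proof -
  have "(\<Sum>u\<in>U. real (n u)) \<le> real (card U) * real k"
    using le by (metis of_nat_le_iff of_nat_mult of_nat_sum)
  then have "0 \<le> ((\<Sum>u\<in>U. real (n u)) - real (card U) * real k) * ln q"
    using assms by (intro mult_nonpos_nonpos) auto
  then have "q ^ k * real (card U) \<le>
      q ^ k * (real (card U) + ((\<Sum>u\<in>U. real (n u)) - real (card U) * real k) * ln q)"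
    using assms by (intro mult_left_mono) auto
  also have "\<dots> = (\<Sum>u\<in>U. q ^ k * (1 + (real (n u) - real k) * ln q))"
    by (simp add: sum_distrib_left[symmetric] sum.distrib sum_distrib_right[symmetric]
        sum_subtractf)
  also have "\<dots> \<le> (\<Sum>u\<in>U. q ^ n u)"
    using assms by (intro sum_mono power_ge_tangent)
  finally show ?thesis
    by (simp add: mult.commute)
qed

text \<open>For a fixed probe list, \<open>u\<close> is missed exactly when all its
  \<open>card (N u)\<close> independent probes fail; convexity then makes an even spread of the
  probes the best one.\<close>

lemma expected_hits_le:
  fixes U :: "'u set" and V :: "'v set" and p :: real
  assumes fin: "finite U" "finite V" and p: "0 \<le> p" "p < 1"
    and L: "set L \<subseteq> U \<times> V" "\<And>v. v \<in> V \<Longrightarrow> length (filter (\<lambda>e. snd e = v) L) \<le> 1"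
    and V: "card V \<le> card U * k"
  shows "measure_pmf.expectation (Pi_pmf (U \<times> V) False (\<lambda>_. bernoulli_pmf p))
      (\<lambda>\<sigma>. real (card {u \<in> U. \<exists>e\<in>set L. fst e = u \<and> \<sigma> e})) \<le> card U * (1 - (1 - p) ^ k)"
proof -
  define D where "D = Pi_pmf (U \<times> V) False (\<lambda>_. bernoulli_pmf p)"
  define N where "N u = {e \<in> set L. fst e = u}" for u
  have D: "finite (set_pmf D)"
    unfolding D_def using fin by (intro finite_set_Pi_bernoulli) auto
  \<comment> \<open>At most one probe per online vertex bounds the total number of probes by
    \<open>card V\<close>.\<close>
  have "inj_on snd (set L)"
  proof (rule inj_onI)
    fix e e' assume e: "e \<in> set L" "e' \<in> set L" "snd e = snd e'"
    let ?L = "filter (\<lambda>d. snd d = snd e) L"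
    have "x = y" if "length xs \<le> 1" "x \<in> set xs" "y \<in> set xs" for x y and xs :: "('u \<times> 'v) list"
      using that by (cases xs) auto
    moreover have "length ?L \<le> 1" "e \<in> set ?L" "e' \<in> set ?L"
      using e L by auto
    ultimately show "e = e'"
      by blast
  qed
  then have "card (set L) \<le> card V"
    using L fin by (intro card_inj_on_le[of snd]) auto
  moreover have "(\<Sum>u\<in>U. card (N u)) = card (set L)"
  proof -
    have "set L = (\<Union>u\<in>U. N u)"
      using L by (auto simp: N_def)
    moreover have "card (\<Union>u\<in>U. N u) = (\<Sum>u\<in>U. card (N u))"
      using fin by (intro card_UN_disjoint) (auto simp: N_def)
    ultimately show ?thesis
      by simp
  qed
  ultimately have N: "(\<Sum>u\<in>U. card (N u)) \<le> card U * k"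
    using V by simp
  have hit: "measure_pmf.prob D {\<sigma>. \<exists>e\<in>N u. \<sigma> e} = 1 - (1 - p) ^ card (N u)" for u
  proof -
    have "N u \<subseteq> U \<times> V"
      using L by (auto simp: N_def)
    then have "measure_pmf.prob D {\<sigma>. \<forall>e\<in>N u. \<not> \<sigma> e} = (1 - p) ^ card (N u)"
      unfolding D_def using fin p by (intro prob_Pi_bernoulli_all_False) auto
    moreover have "{\<sigma>. \<exists>e\<in>N u. \<sigma> e} = UNIV - {\<sigma>. \<forall>e\<in>N u. \<not> \<sigma> e}"
      by auto
    ultimately show ?thesis
      using measure_pmf.prob_compl[of "{\<sigma>. \<forall>e\<in>N u. \<not> \<sigma> e}" D] by simp
  qed
  have "measure_pmf.expectation D (\<lambda>\<sigma>. real (card {u \<in> U. \<exists>e\<in>set L. fst e = u \<and> \<sigma> e})) =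
      measure_pmf.expectation D (\<lambda>\<sigma>. \<Sum>u\<in>U. indicator {\<sigma>. \<exists>e\<in>N u. \<sigma> e} \<sigma>)"
  proof (intro Bochner_Integration.integral_cong refl)
    fix \<sigma>
    have "(\<Sum>u\<in>U. indicator {\<sigma>. \<exists>e\<in>N u. \<sigma> e} \<sigma>) = (\<Sum>u\<in>U. if \<exists>e\<in>N u. \<sigma> e then 1 else 0 :: real)"
      by (intro sum.cong) (auto simp: indicator_def)
    also have "\<dots> = real (card {u \<in> U. \<exists>e\<in>N u. \<sigma> e})"
      using fin by (simp add: sum.If_cases Int_def)
    also have "{u \<in> U. \<exists>e\<in>N u. \<sigma> e} = {u \<in> U. \<exists>e\<in>set L. fst e = u \<and> \<sigma> e}"
      unfolding N_def by blast
    finally show "real (card {u \<in> U. \<exists>e\<in>set L. fst e = u \<and> \<sigma> e}) =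
        (\<Sum>u\<in>U. indicator {\<sigma>. \<exists>e\<in>N u. \<sigma> e} \<sigma>)" ..
  qed
  also have "\<dots> = (\<Sum>u\<in>U. measure_pmf.prob D {\<sigma>. \<exists>e\<in>N u. \<sigma> e})"
    using D by (subst Bochner_Integration.integral_sum) (auto intro: integrable_measure_pmf_finite)
  also have "\<dots> = real (card U) - (\<Sum>u\<in>U. (1 - p) ^ card (N u))"
    by (simp add: hit sum_subtractf)
  also have "\<dots> \<le> real (card U) * (1 - (1 - p) ^ k)"
    using card_mult_power_le_sum_power[of "1 - p" "\<lambda>u. card (N u)" U k] N p
    by (simp add: right_diff_distrib)
  finally show ?thesis
    by (simp add: D_def)
qed

text \<open>Acceptance decisions may still depend on the states, so the matching is first bounded by
  a quantity that ignores them: the number of offline vertices with an active probed edge.\<close>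

lemma non_adaptive_expected_weight_le:
  fixes U :: "'u set" and V :: "'v set" and p :: real
  assumes fin: "finite U" "finite V" and p: "0 \<le> p" "p < 1" and V: "card V \<le> card U * k"
  defines "G \<equiv> unit_patience U V p"
  assumes A: "offline_probing G A" "non_adaptive G A"
  shows "expected_weight G A \<le> card U * (1 - (1 - p) ^ k)"
proof -
  \<comment> \<open>\<open>H\<close> sees the decision tree only through its probe list, which is
    the part that \<open>non_adaptive\<close> makes independent of the states.\<close>
  define H where "H = (\<lambda>(L :: ('u \<times> 'v) list, \<sigma>).
    real (card {u \<in> U. \<exists>e\<in>set L. fst e = u \<and> \<sigma> e}))"
  let ?X = "execution G A"
  have H: "0 \<le> H x" "H x \<le> card U" for x
    using fin by (auto simp: H_def split: prod.splits intro!: card_mono)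
  have valid: "set (probed T \<sigma>) \<subseteq> U \<times> V"
      "\<And>v. v \<in> V \<Longrightarrow> length (filter (\<lambda>e. snd e = v) (probed T \<sigma>)) \<le> 1"
      "is_matching G (matched T \<sigma>)"
    if "(T, \<sigma>) \<in> set_pmf ?X" for T \<sigma>
    using A(1) that unfolding offline_probing_def G_def by fastforce+
  have le: "(\<Sum>e\<in>matched T \<sigma>. weight G e) \<le> H (probed T \<sigma>, \<sigma>)"
    if x: "(T, \<sigma>) \<in> set_pmf ?X" for T \<sigma>
  proof -
    have M: "inj_on fst (matched T \<sigma>)" "matched T \<sigma> \<subseteq> U \<times> V"
      using valid(3)[OF x] by (auto simp: is_matching_def G_def)
    have "fst ` matched T \<sigma> \<subseteq> {u \<in> U. \<exists>e\<in>set (probed T \<sigma>). fst e = u \<and> \<sigma> e}"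
      using M(2) matched_subset_probed[of T \<sigma>] by fastforce
    then have "card (matched T \<sigma>) \<le> card {u \<in> U. \<exists>e\<in>set (probed T \<sigma>). fst e = u \<and> \<sigma> e}"
      using fin M(1) by (intro card_inj_on_le[of fst]) auto
    then show ?thesis
      by (simp add: G_def H_def)
  qed
  have int: "integrable ?X (\<lambda>(T, \<sigma>). H (probed T \<sigma>, \<sigma>))"
    by (rule measure_pmf.integrable_const_bound[where B = "card U"]) (use H in auto)
  have "expected_weight G A \<le> measure_pmf.expectation ?X (\<lambda>(T, \<sigma>). H (probed T \<sigma>, \<sigma>))"
    unfolding expected_weight_def
  proof (rule integral_mono_AE[OF _ int])
    show "integrable ?X (\<lambda>(T, \<sigma>). \<Sum>e\<in>matched T \<sigma>. weight G e)"
    proof (rule measure_pmf.integrable_const_bound[where B = "card U"])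
      have "norm (\<Sum>e\<in>matched T \<sigma>. weight G e) \<le> card U" if "(T, \<sigma>) \<in> set_pmf ?X" for T \<sigma>
        using le[OF that] H(2)[of "(probed T \<sigma>, \<sigma>)"] by (simp add: G_def)
      then show "AE x in ?X. norm (case x of (T, \<sigma>) \<Rightarrow> \<Sum>e\<in>matched T \<sigma>. weight G e) \<le> card U"
        by (auto simp: AE_measure_pmf_iff)
    qed auto
  qed (use le in \<open>auto simp: AE_measure_pmf_iff\<close>)
  also have "\<dots> = measure_pmf.expectation (map_pmf (\<lambda>(T, \<sigma>). (probed T \<sigma>, \<sigma>)) ?X) H"
    by (simp add: case_prod_unfold)
  also have "\<dots> = measure_pmf.expectation
      (pair_pmf (map_pmf (\<lambda>(T, \<sigma>). probed T \<sigma>) ?X) (edge_states G)) H"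
    using A(2) by (simp add: non_adaptive_def)
  also have "\<dots> \<le> card U * (1 - (1 - p) ^ k)"
  proof (rule expectation_pair_pmf_le)
    show "finite (set_pmf (edge_states G))"
      unfolding G_def unit_patience_sel using fin by (intro finite_set_Pi_bernoulli) auto
  next
    show "0 \<le> real (card U) * (1 - (1 - p) ^ k)"
      using p by (simp add: power_le_one)
  next
    fix L assume "L \<in> set_pmf (map_pmf (\<lambda>(T, \<sigma>). probed T \<sigma>) ?X)"
    then have "set L \<subseteq> U \<times> V" "\<And>v. v \<in> V \<Longrightarrow> length (filter (\<lambda>e. snd e = v) L) \<le> 1"
      using valid(1,2) by auto
    then show "measure_pmf.expectation (edge_states G) (\<lambda>b. H (L, b)) \<le>
        card U * (1 - (1 - p) ^ k)"
      unfolding G_def H_def unit_patience_sel split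
      by (intro expected_hits_le fin p V)
  qed (rule H)
  finally show ?thesis .
qed

section \<open>An adaptive algorithm\<close>

fun greedy :: "'v list \<Rightarrow> 'u list \<Rightarrow> ('u \<times> 'v) strategy" where
  "greedy [] us = Stop"
| "greedy (v # vs) [] = Stop"
| "greedy (v # vs) (u # us) = Probe (u, v) (greedy vs (u # us)) True (greedy vs us)"

lemma set_probed_greedy: "set (probed (greedy vs us) \<sigma>) \<subseteq> set us \<times> set vs"
  by (induction vs us rule: greedy.induct) auto

lemma length_filter_probed_greedy:
  "distinct vs \<Longrightarrow> length (filter (\<lambda>e. snd e = v) (probed (greedy vs us) \<sigma>)) \<le> 1"
proof (induction vs us rule: greedy.induct)
  case (3 w vs u us)
  have "filter (\<lambda>e. snd e = w) (probed (greedy vs xs) \<sigma>) = []" for xs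
    using set_probed_greedy[of vs xs \<sigma>] 3(3) by (fastforce simp: filter_empty_conv)
  then show ?case
    using 3 by auto
qed auto

lemma matched_greedy_subset: "matched (greedy vs us) \<sigma> \<subseteq> set us \<times> set vs"
  using matched_subset_probed[of "greedy vs us" \<sigma>] set_probed_greedy[of vs us \<sigma>] by auto

lemma inj_on_matched_greedy:
  assumes "distinct vs" "distinct us"
  shows "inj_on fst (matched (greedy vs us) \<sigma>) \<and> inj_on snd (matched (greedy vs us) \<sigma>)"
  using assms
proof (induction vs us rule: greedy.induct)
  case (3 v vs u us)
  have "u \<notin> fst ` matched (greedy vs us) \<sigma>" "v \<notin> snd ` matched (greedy vs us) \<sigma>"
    using matched_greedy_subset[of vs us \<sigma>] 3(3,4) by auto
  then show ?case
    using 3 by auto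
qed auto

text \<open>The tree never probes an edge at \<open>v\<close>. Hence, after a probe of
  \<open>(u, v)\<close>, the rest of the run is unaffected by conditioning on its outcome.\<close>

lemma matched_greedy_upd:
  "v \<notin> set vs \<Longrightarrow> matched (greedy vs us) (\<sigma>((u, v) := b)) = matched (greedy vs us) \<sigma>"
  by (induction vs us rule: greedy.induct) auto

text \<open>
  The lower bound is the expectation of \<open>(X + k)/2 - s/4 - (X - k)\<^sup>2/(4 s)\<close> for a binomial variable
  \<open>X\<close> with parameters \<open>n = length vs\<close> and \<open>p\<close>, and \<open>k = length us\<close>. This quadratic polynomial is at
  most \<open>min k X\<close> by the inequality \<open>2 \<bar>X - k\<bar> \<le> s + (X - k)\<^sup>2/s\<close>, and its expectation satisfies the
  same recurrence as the expected size of the greedy matching.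
\<close>

lemma expectation_card_matched_greedy_ge:
  fixes p s :: real
  assumes fin: "finite E" and p: "0 \<le> p" "p \<le> 1" and s: "0 < s"
    and "distinct vs" "distinct us" "set us \<times> set vs \<subseteq> E"
  shows "(real (length vs) * p + length us) / 2 - s / 4
      - ((real (length vs) * p - length us)\<^sup>2 + length vs * p * (1 - p)) / (4 * s)
    \<le> measure_pmf.expectation (Pi_pmf E False (\<lambda>_. bernoulli_pmf p))
        (\<lambda>\<sigma>. real (card (matched (greedy vs us) \<sigma>)))"
  using assms(5-)
proof (induction vs us rule: greedy.induct)
  case (1 us)
  \<comment> \<open>In both base cases the matching is empty, and completing the square shows that
    the bound is at most 0.\<close>
  have "0 \<le> (real (length us) - s)\<^sup>2 / (4 * s)"
    using s by simp
  also have "\<dots> = - (real (length us) / 2 - s / 4 - (real (length us))\<^sup>2 / (4 * s))"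
    using s by (simp add: field_simps power2_eq_square)
  finally show ?case
    by simp
next
  case (2 v vs)
  define m where "m = real (length (v # vs))"
  have "0 \<le> (m * p - s)\<^sup>2 / (4 * s) + m * p * (1 - p) / (4 * s)"
    using s p by (simp add: m_def)
  also have "\<dots> = - (m * p / 2 - s / 4 - ((m * p)\<^sup>2 + m * p * (1 - p)) / (4 * s))"
    using s by (simp add: field_simps power2_eq_square)
  finally show ?case
    by (simp add: m_def del: of_nat_Suc)
next
  case (3 v vs u us)
  let ?E = "measure_pmf.expectation (Pi_pmf E False (\<lambda>_. bernoulli_pmf p))"
  let ?f = "\<lambda>vs us \<sigma>. real (card (matched (greedy vs us) \<sigma>))"
  define n k where "n = real (length vs)" and "k = real (length us)"
  define h where "h n k = (n * p + k) / 2 - s / 4 - ((n * p - k)\<^sup>2 + n * p * (1 - p)) / (4 * s)"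
    for n k
  have D: "finite (set_pmf (Pi_pmf E False (\<lambda>_. bernoulli_pmf p)))"
    using fin by (rule finite_set_Pi_bernoulli)
  have active: "?f (v # vs) (u # us) (\<sigma>((u, v) := True)) = 1 + ?f vs us \<sigma>" for \<sigma>
  proof -
    have "(u, v) \<notin> matched (greedy vs us) \<sigma>" "finite (matched (greedy vs us) \<sigma>)"
      using matched_greedy_subset[of vs us \<sigma>] 3(3) finite_subset by fastforce+
    then show ?thesis
      using 3(3) by (simp add: matched_greedy_upd)
  qed
  have inactive: "?f (v # vs) (u # us) (\<sigma>((u, v) := False)) = ?f vs (u # us) \<sigma>" for \<sigma>
    using 3(3) by (simp add: matched_greedy_upd)
  have IH: "h n (k + 1) \<le> ?E (?f vs (u # us))" "h n k \<le> ?E (?f vs us)"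
    using 3 by (auto simp: h_def n_def k_def add.commute)
  \<comment> \<open>On success X and the capacity both grow by 1, which keeps X - k and raises (X +
    k)/2 by 1; on failure X stays the same while the capacity is still k + 1.\<close>
  have "h (n + 1) (k + 1) = p * (1 + h n k) + (1 - p) * h n (k + 1)"
    using s by (simp add: h_def field_simps power2_eq_square)
  also have "\<dots> \<le> p * (1 + ?E (?f vs us)) + (1 - p) * ?E (?f vs (u # us))"
    using IH p by (intro add_mono mult_left_mono) auto
  also have "\<dots> = ?E (?f (v # vs) (u # us))"
    using fin p 3(5) D
    by (subst expectation_Pi_bernoulli_split[of E "(u, v)" "\<lambda>_. p"])
      (auto simp: active inactive integrable_measure_pmf_finite simp del: greedy.simps)
  finally show ?case
    by (simp add: h_def n_def k_def add.commute)
qed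

lemma OPT_unit_patience_ge:
  fixes p s :: real
  assumes fin: "finite U" "finite V" and p: "0 \<le> p" "p \<le> 1" and s: "0 < s"
  shows "(real (card V) * p + card U) / 2 - s / 4
      - ((real (card V) * p - card U)\<^sup>2 + card V * p * (1 - p)) / (4 * s)
    \<le> OPT (unit_patience U V p)"
proof -
  let ?G = "unit_patience U V p"
  obtain us where us: "set us = U" "distinct us"
    using finite_distinct_list fin by blast
  obtain vs where vs: "set vs = V" "distinct vs"
    using finite_distinct_list fin by blast
  let ?A = "return_pmf (greedy vs us)"
  have card: "card U = length us" "card V = length vs"
    using us vs distinct_card by fastforce+
  have "offline_probing ?G ?A"
    unfolding offline_probing_def execution_def is_matching_def
    using set_probed_greedy[of vs us] matched_greedy_subset[of vs us] us vs
      length_filter_probed_greedy[OF vs(2)] inj_on_matched_greedy[OF vs(2) us(2)]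
    by fastforce
  then have "expected_weight ?G ?A \<le> OPT ?G"
    unfolding OPT_def
    using OPT_set_bdd_above[OF stochastic_graph_unit_patience[OF fin p]]
    by (intro cSup_upper) auto
  moreover have "expected_weight ?G ?A =
      measure_pmf.expectation (Pi_pmf (U \<times> V) False (\<lambda>_. bernoulli_pmf p))
        (\<lambda>\<sigma>. real (card (matched (greedy vs us) \<sigma>)))"
    by (simp add: expected_weight_def execution_def pair_return_pmf1)
  ultimately show ?thesis
    using expectation_card_matched_greedy_ge[of "U \<times> V" p s vs us] fin p s us vs
    by (simp add: card)
qed

section \<open>The limit ratio\<close>

theorem theorem5:
  shows "\<not> (\<exists>(A :: ('u::infinite, 'v::infinite) sgraph \<Rightarrow> ('u \<times> 'v) strategy pmf) (c::real).
    (\<forall>G. stochastic_graph G \<longrightarrow> offline_probing G (A G) \<and> non_adaptive G (A G)) \<and>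
    c > 1 - 1 / exp 1 \<and>
    (\<forall>G. stochastic_graph G \<longrightarrow> expected_weight G (A G) \<ge> c * OPT G))"
proof safe
  fix A :: "('u, 'v) sgraph \<Rightarrow> ('u \<times> 'v) strategy pmf" and c :: real
  assume A: "\<forall>G. stochastic_graph G \<longrightarrow> offline_probing G (A G) \<and> non_adaptive G (A G)"
    and c: "c > 1 - 1 / exp 1"
    and ratio: "\<forall>G. stochastic_graph G \<longrightarrow> expected_weight G (A G) \<ge> c * OPT G"
  \<comment> \<open>Positivity of \<open>c\<close> allows the lower bound on \<open>OPT\<close> to
    be multiplied by it.\<close>
  have "0 < 1 - 1 / exp (1::real)"
    by simp
  with c have "0 < c"
    by linarith
  have bound: "c * (1 - 1 / (2 * real m)) \<le> 1 - (1 + (-1) / real (m\<^sup>2)) ^ (m\<^sup>2)"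
    if m: "2 \<le> m" for m :: nat
  proof -
    \<comment> \<open>A square \<open>k\<close> makes its root \<open>m\<close> available as the
      parameter \<open>s\<close>, which balances \<open>s / 4\<close> against the variance
      term.\<close>
    define k where "k = m\<^sup>2"
    have k: "1 < k"
      using m by (simp add: k_def power2_eq_square less_1_mult del: One_nat_def)
    obtain U :: "'u set" where U: "finite U" "card U = k"
      using infinite_arbitrarily_large[OF infinite_UNIV] by blast
    obtain V :: "'v set" where V: "finite V" "card V = k * k"
      using infinite_arbitrarily_large[OF infinite_UNIV] by blast
    let ?p = "1 / real k"
    let ?G = "unit_patience U V ?p"
    have p: "0 \<le> ?p" "?p < 1"
      using k by auto
    have G: "stochastic_graph ?G"
      using U V p by (intro stochastic_graph_unit_patience) auto
    \<comment> \<open>The mean is exactly \<open>k\<close>, so the squared deviation vanishes. The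
      variance k - 1 costs at most \<open>m / 4\<close>, and \<open>s / 4\<close> costs another
      \<open>m / 4\<close>.\<close>
    have "real k - m / 2 \<le> (real (k * k) * ?p + k) / 2 - real m / 4
        - ((real (k * k) * ?p - k)\<^sup>2 + real (k * k) * ?p * (1 - ?p)) / (4 * real m)"
    proof -
      have *: "real (k * k) * ?p = k" "real k * (1 - ?p) = real k - 1"
        using k by (auto simp: field_simps)
      have "(real k - 1) / (4 * m) \<le> m / 4"
        using m by (simp add: k_def field_simps power2_eq_square)
      then have "real k - m / 2 \<le> real k - m / 4 - (real k - 1) / (4 * m)"
        by linarith
      then show ?thesis
        unfolding * by simp
    qed
    also have "\<dots> \<le> OPT ?G"
      using OPT_unit_patience_ge[of U V ?p "real m"] U V p m by simp
    finally have "c * (real k - m / 2) \<le> c * OPT ?G"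
      using \<open>0 < c\<close> by simp
    also have "\<dots> \<le> expected_weight ?G (A ?G)"
      using ratio G by blast
    also have "\<dots> \<le> k * (1 - (1 - ?p) ^ k)"
      using non_adaptive_expected_weight_le[of U V ?p k "A ?G"] A G U V p by simp
    finally have "c * (real k - m / 2) / k \<le> 1 - (1 - ?p) ^ k"
      using k by (simp add: field_simps)
    moreover have "c * (real k - m / 2) / k = c * (1 - 1 / (2 * real m))"
      using m by (simp add: k_def field_simps power2_eq_square)
    ultimately show ?thesis
      by (simp add: k_def)
  qed
  \<comment> \<open>Along the squares the left side of \<open>bound\<close> tends to
    \<open>c\<close> and the right side to 1 - 1/e, contradicting the choice of
    \<open>c\<close>.\<close>
  have "filterlim (\<lambda>m::nat. m\<^sup>2) at_top at_top"
    by (rule filterlim_subseq) (auto simp: strict_mono_def power_strict_mono)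
  from filterlim_compose[OF tendsto_exp_limit_sequentially[of "-1"] this]
  have "(\<lambda>m. 1 - (1 + (-1) / real (m\<^sup>2)) ^ (m\<^sup>2)) \<longlonglongrightarrow> 1 - exp (-1)"
    by (intro tendsto_intros)
  moreover have "(\<lambda>m. c * (1 - 1 / (2 * real m))) \<longlonglongrightarrow> c * (1 - 0)"
    using tendsto_mult[OF tendsto_const[of "1/2"] lim_1_over_n]
    by (intro tendsto_intros) simp
  ultimately have "c * (1 - 0) \<le> 1 - exp (-1)"
    using bound by (intro LIMSEQ_le) blast+
  with c show False
    by (simp add: exp_minus inverse_eq_divide)
qed

end
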